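(* Let $A=(a_1,\dots,a_k)$ be a real-valued pinwheel instance whose periods $a_1,\dots,a_k$ take exactly three distinct values (each value may occur any number of times), and suppose $D(A)=\sum_{i=1}^k \frac{1}{a_i}\le \frac{5}{6}$. Then $A$ is schedulable.
   Context: A real-valued pinwheel instance is a finite sequence $A=(a_1,\dots,a_k)$ of real numbers $a_i\ge 1$; $a_i$ is the period of task $i$. A schedule is a map $S:\mathbb{Z}\to\{1,\dots,k\}$ ($S(t)$ is the task performed on day $t$). $S$ is valid for $A$ if for every task $i$, every positive integer $l$ and every $m\in\mathbb{Z}$, there are at least $l$ integers $t$ with $m\le t< m+\lceil l a_i\rceil$ and $S(t)=i$. $A$ is schedulable if some schedule is valid for it. The density of $A$ is $D(A)=\sum_{i=1}^k 1/a_i$. *)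

theory Defs
  imports Complex_Main
begin

(* An instance (a_1, ..., a_k) is a list of periods; tasks are the list positions,
   so they are numbered 0, ..., k - 1. *)
definition pinwheel_instance :: "real list \<Rightarrow> bool" where
  "pinwheel_instance A \<longleftrightarrow> (\<forall>a\<in>set A. a \<ge> 1)"

definition schedule :: "real list \<Rightarrow> (int \<Rightarrow> nat) \<Rightarrow> bool" where
  "schedule A S \<longleftrightarrow> (\<forall>t. S t < length A)"

definition valid_schedule :: "real list \<Rightarrow> (int \<Rightarrow> nat) \<Rightarrow> bool" where
  "valid_schedule A S \<longleftrightarrow> schedule A S \<and>
     (\<forall>i<length A. \<forall>l::nat. l > 0 \<longrightarrow> (\<forall>m::int.
        card {t \<in> {m..<m + \<lceil>real l * A ! i\<rceil>}. S t = i} \<ge> l))"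

definition schedulable :: "real list \<Rightarrow> bool" where
  "schedulable A \<longleftrightarrow> (\<exists>S. valid_schedule A S)"

definition density :: "real list \<Rightarrow> real" where
  "density A = (\<Sum>i<length A. 1 / A ! i)"

end

theory Submission
  imports Defs "HOL-Library.Disjoint_Sets"
begin

text \<open>
  Tasks of equal period can share the days of one task of \<open>u\<close> times the frequency in round-robin
  order, so only three tasks with real periods \<open>a \<le> b \<le> c\<close> and rates \<open>p \<ge> q \<ge> r\<close> remain, where
  \<open>p + q + r \<le> 5 / 6\<close>. If \<open>p + 2 q \<le> 1\<close> or \<open>r + 2 p \<le> 1\<close>, one task is placed on a Beatty sequence
  and the other two alternate on its complement. Otherwise \<open>q - r > 1 / 6\<close> and \<open>p - q > 1 / 6\<close>,
  hence \<open>b > 3\<close> and \<open>c > 9\<close>, and four periodic schedules suffice. They exploit the rounding up of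
  \<open>l b\<close>: when \<open>b\<close> lies strictly above an integer \<open>k\<close>, task \<open>b\<close> only needs \<open>l\<close> executions in
  \<open>k l + 1\<close> days.
\<close>

section \<open>Day sets, their counting functions, and round-robin sharing\<close>

text \<open>This is validity for one task, stated for its set of days. Days may stay idle, so
  several tasks only need disjoint sets; \<open>schedulable_if_disjoint\<close> fills the
  gaps.\<close>

definition serves :: "int set \<Rightarrow> real \<Rightarrow> bool" where
  "serves P a \<longleftrightarrow> (\<forall>l::nat. l > 0 \<longrightarrow> (\<forall>m. l \<le> card (P \<inter> {m..<m + \<lceil>real l * a\<rceil>})))"

text \<open>\<open>N M - N m\<close> is then the number of days of \<open>P\<close> in \<open>{m..<M}\<close>.\<close>
definition counts :: "(int \<Rightarrow> int) \<Rightarrow> int set \<Rightarrow> bool" where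
  "counts N P \<longleftrightarrow> (\<forall>t. N (t + 1) = N t + of_bool (t \<in> P))"

lemma counts_card:
  assumes "counts N P" and "m \<le> M"
  shows "int (card (P \<inter> {m..<M})) = N M - N m"
  using assms(2)
proof (induction M rule: int_ge_induct)
  case base
  then show ?case by simp
next
  case (step M)
  have eq: "P \<inter> {m..<M + 1} = (if M \<in> P then insert M (P \<inter> {m..<M}) else P \<inter> {m..<M})"
    using step.hyps by (auto simp: less_le)
  show ?case
    using step.IH assms(1) unfolding counts_def eq by (auto simp: card_insert_if)
qed

text \<open>Normalise by \<open>N 0 = 0\<close>: count forwards from day 0 and, with a minus sign,
  backwards before it.\<close>

lemma counts_exists: "\<exists>N. counts N P"
proof -
  define N where "N t = int (card (P \<inter> {0..<t})) - int (card (P \<inter> {t..<0}))" for t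
  have "N (t + 1) = N t + of_bool (t \<in> P)" for t
  proof (cases "t \<ge> 0")
    case True
    then have "P \<inter> {0..<t + 1} = (if t \<in> P then insert t (P \<inter> {0..<t}) else P \<inter> {0..<t})"
      by (auto simp: less_le)
    with True show ?thesis by (auto simp: N_def card_insert_if)
  next
    case False
    then have "P \<inter> {t..<0} = (if t \<in> P then insert t (P \<inter> {t + 1..<0}) else P \<inter> {t + 1..<0})"
      by (auto simp: add1_zle_eq less_le)
    with False show ?thesis by (auto simp: N_def card_insert_if)
  qed
  then show ?thesis unfolding counts_def by blast
qed

lemma serves_mono:
  assumes "serves P a" and "a \<le> b"
  shows "serves P b"
  unfolding serves_def
proof (intro allI impI)
  fix l :: nat and m :: int
  assume "l > 0"
  then have "l \<le> card (P \<inter> {m..<m + \<lceil>real l * a\<rceil>})"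
    using assms(1) by (auto simp: serves_def)
  also have "\<lceil>real l * a\<rceil> \<le> \<lceil>real l * b\<rceil>"
    by (intro ceiling_mono mult_left_mono assms) simp
  then have "card (P \<inter> {m..<m + \<lceil>real l * a\<rceil>}) \<le> card (P \<inter> {m..<m + \<lceil>real l * b\<rceil>})"
    by (intro card_mono) auto
  finally show "l \<le> card (P \<inter> {m..<m + \<lceil>real l * b\<rceil>})" .
qed

text \<open>Deal the days of \<open>P\<close> in turn to \<open>u\<close> tasks. The window for
  \<open>l\<close> executions at period \<open>u * a\<close> is the window in which \<open>P\<close>
  guarantees \<open>l * u\<close> days, and any \<open>l * u\<close> successive days of
  \<open>P\<close> contain exactly \<open>l\<close> of each residue class.\<close>

lemma serves_split:
  assumes P: "serves P a" and u: "u > 0"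
  shows "\<exists>Q :: nat \<Rightarrow> int set. disjoint_family Q \<and> (\<forall>j. Q j \<subseteq> P) \<and> (\<forall>j<u. serves (Q j) (real u * a))"
proof -
  obtain N where N: "counts N P" using counts_exists by blast
  define Q where "Q j = {t \<in> P. N t mod int u = int j}" for j
  have "serves (Q j) (real u * a)" if j: "j < u" for j
    unfolding serves_def
  proof (intro allI impI)
    fix l :: nat and m :: int
    assume l: "l > 0"
    define M where "M = m + \<lceil>real l * (real u * a)\<rceil>"
    \<comment> \<open>This is the ceiling of \<open>(N t - j) / u\<close>, which rises by one
      exactly when \<open>N\<close> leaves a value congruent to \<open>j\<close> modulo
      \<open>u\<close>.\<close>
    define K where "K t = (N t + int u - 1 - int j) div int u" for t
    have "counts K (Q j)"
      unfolding counts_def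
    proof
      fix t
      obtain d r where d: "N t = int u * d + r" and r: "0 \<le> r" "r < int u"
        using u by (metis mult_div_mod_eq of_nat_0_less_iff pos_mod_bound pos_mod_sign)
      have 1: "N t mod int u = r" using d r by simp
      have K: "K t = d + (r + int u - 1 - int j) div int u"
        using div_mult_self2[of "int u" "r + int u - 1 - int j" d] u
        unfolding K_def d by (simp add: algebra_simps)
      have "N (t + 1) = int u * d + r + of_bool (t \<in> P)"
        using N d by (simp add: counts_def)
      then have K': "K (t + 1) = d + (r + of_bool (t \<in> P) + int u - 1 - int j) div int u"
        using div_mult_self2[of "int u" "r + of_bool (t \<in> P) + int u - 1 - int j" d] u
        unfolding K_def by (simp add: algebra_simps)
      \<comment> \<open>Here \<open>e\<close> is the increment of \<open>N\<close>. The numerator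
        lies between 0 and \<open>2 * u - 1\<close>, so the quotient is 0 or 1, and \<open>K\<close>
        rises exactly when \<open>r = j\<close> and \<open>t\<close> is in \<open>P\<close>.\<close>
      have 2: "(r + e + int u - 1 - int j) div int u = of_bool (r + e > int j)"
        if "0 \<le> e" "e \<le> 1" for e
      proof (cases "r + e > int j")
        case True
        have "(r + e + int u - 1 - int j) div int u = 1"
          by (rule int_div_pos_eq[where r = "r + e - 1 - int j"]) (use True that r in auto)
        with True show ?thesis by simp
      next
        case False
        then show ?thesis using that r j by simp
      qed
      show "K (t + 1) = K t + of_bool (t \<in> Q j)"
        using 2[of 0] 2[of "of_bool (t \<in> P)"] unfolding K K' Q_def using 1 by (auto simp: of_bool_def)
    qed
    have lu: "l * u \<le> card (P \<inter> {m..<M})"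
      using P l u unfolding serves_def M_def
      by (metis (no_types, opaque_lifting) mult.assoc nat_0_less_mult_iff of_nat_mult)
    \<comment> \<open>The sign of \<open>a\<close> is unknown, so the order of the endpoints is read
      off from the window containing \<open>l * u > 0\<close> days.\<close>
    have "m \<le> M"
    proof (rule ccontr)
      assume "\<not> m \<le> M"
      then have "P \<inter> {m..<M} = {}" by auto
      with lu l u show False by simp
    qed
    from lu have "N m + int u * int l \<le> N M"
      using counts_card[OF N \<open>m \<le> M\<close>] by (simp add: mult.commute flip: of_nat_mult)
    then have "(N m + int u - 1 - int j + int u * int l) div int u \<le> K M"
      unfolding K_def by (intro zdiv_mono1) (use u in auto)
    then have "K m + int l \<le> K M" unfolding K_def using u by simp
    then show "l \<le> card (Q j \<inter> {m..<m + \<lceil>real l * (real u * a)\<rceil>})"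
      using counts_card[OF \<open>counts K (Q j)\<close> \<open>m \<le> M\<close>] unfolding M_def[symmetric] by simp
  qed
  moreover have "disjoint_family Q" unfolding disjoint_family_on_def Q_def by auto
  moreover have "\<forall>j. Q j \<subseteq> P" by (auto simp: Q_def)
  ultimately show ?thesis by blast
qed

section \<open>Beatty sequences\<close>

text \<open>\<open>P\<close> consists of the days on which the floor of \<open>t * x\<close> jumps,
  where \<open>x = 1 / a\<close>. The floor is superadditive, so \<open>L\<close> days contain at
  least floor(\<open>L * x\<close>) of them. The complement is counted by the ceiling of
  \<open>t * (1 - x)\<close>, which gives at least floor(\<open>L * (1 - x)\<close>) days, and
  \<open>1 / b <= 1 - x\<close>.\<close>

lemma serves_beatty:
  assumes a: "a > 0" and b: "b > 0" and ab: "1 / a + 1 / b \<le> 1"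
  shows "\<exists>P. serves P a \<and> serves (- P) b"
proof -
  define x where "x = 1 / a"
  have "0 < 1 / a" "0 < 1 / b" using a b by simp_all
  then have x: "0 \<le> x" "x \<le> 1" using ab unfolding x_def by linarith+
  define N where "N t = \<lfloor>of_int t * x\<rfloor>" for t :: int
  define P where "P = {t. N t < N (t + 1)}"
  have "N t \<le> N (t + 1) \<and> N (t + 1) \<le> N t + 1" for t
    using x unfolding N_def by (simp add: algebra_simps) linarith
  then have "N (t + 1) = N t + of_bool (t \<in> P)" for t
    unfolding P_def by (smt (verit) mem_Collect_eq of_bool_eq)
  then have N: "counts N P" by (simp add: counts_def)
  then have N': "counts (\<lambda>t. t - N t) (- P)" by (simp add: counts_def)
  have "serves P a"
    unfolding serves_def
  proof (intro allI impI)
    fix l :: nat and m :: int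
    assume l: "l > 0"
    define L where "L = \<lceil>real l * a\<rceil>"
    have L: "real l * a \<le> of_int L" by (simp add: L_def)
    then have "0 \<le> L" using a by (smt (verit) mult_nonneg_nonneg of_int_0_le_iff of_nat_0_le_iff)
    have "real l \<le> of_int L * x" using L a by (simp add: x_def field_simps)
    then have "int l \<le> N (m + L) - N m" unfolding N_def by (simp add: algebra_simps) linarith
    then show "l \<le> card (P \<inter> {m..<m + \<lceil>real l * a\<rceil>})"
      using counts_card[OF N, of m "m + L"] \<open>0 \<le> L\<close> by (simp add: L_def)
  qed
  moreover have "serves (- P) b"
    unfolding serves_def
  proof (intro allI impI)
    fix l :: nat and m :: int
    assume l: "l > 0"
    define L where "L = \<lceil>real l * b\<rceil>"
    have L: "real l * b \<le> of_int L" by (simp add: L_def)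
    then have "0 \<le> L" using b by (smt (verit) mult_nonneg_nonneg of_int_0_le_iff of_nat_0_le_iff)
    have "real l \<le> of_int L * (1 / b)" using L b by (simp add: field_simps)
    also have "\<dots> \<le> of_int L * (1 - x)"
      by (intro mult_left_mono) (use ab \<open>0 \<le> L\<close> in \<open>auto simp: x_def\<close>)
    finally have "int l \<le> (m + L - N (m + L)) - (m - N m)"
      unfolding N_def by (simp add: algebra_simps) linarith
    then show "l \<le> card (- P \<inter> {m..<m + \<lceil>real l * b\<rceil>})"
      using counts_card[OF N', of m "m + L"] \<open>0 \<le> L\<close> by (simp add: L_def)
  qed
  ultimately show ?thesis by blast
qed

section \<open>Periodic schedules from finite words\<close>

text \<open>A list computation replaces the cardinality of a set so that it can be evaluated;
  \<open>card_days\<close> links the two.\<close>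

definition occs :: "nat list \<Rightarrow> nat \<Rightarrow> nat \<Rightarrow> nat \<Rightarrow> nat" where
  "occs ws i r L = length (filter (\<lambda>j. ws ! ((r + j) mod length ws) = i) [0..<L])"

text \<open>\<open>Ls ! s\<close> is a window length that guarantees \<open>s\<close> occurrences, for \<open>s\<close> below the number
  \<open>length Ls\<close> of occurrences per period. The bounded quantifiers make this decidable by \<open>code_simp\<close>.\<close>
definition dense_word :: "nat list \<Rightarrow> nat \<Rightarrow> nat list \<Rightarrow> bool" where
  "dense_word ws i Ls \<longleftrightarrow> (\<forall>r\<in>set [0..<length ws]. length Ls \<le> occs ws i r (length ws)
     \<and> (\<forall>s\<in>set [0..<length Ls]. s \<le> occs ws i r (Ls ! s)))"

definition days :: "nat list \<Rightarrow> nat \<Rightarrow> int set" where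
  "days ws i = {t. ws ! nat (t mod int (length ws)) = i}"

lemma card_days:
  assumes "ws \<noteq> []"
  shows "card (days ws i \<inter> {m..<m + int L}) = occs ws i (nat (m mod int (length ws))) L"
proof -
  define n where "n = length ws"
  have n: "n > 0" using assms by (simp add: n_def)
  define r where "r = nat (m mod int n)"
  have r: "nat ((m + int j) mod int n) = (r + j) mod n" for j
  proof -
    have "(m + int j) mod int n = (int r + int j) mod int n"
      using n by (simp add: r_def mod_add_left_eq)
    then show ?thesis by (simp add: nat_mod_distrib flip: of_nat_add)
  qed
  have "days ws i \<inter> {m..<m + int L} = (\<lambda>j. m + int j) ` {j \<in> {..<L}. ws ! ((r + j) mod n) = i}"
  proof (intro equalityI subsetI)
    fix t assume t: "t \<in> days ws i \<inter> {m..<m + int L}"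
    then have "t = m + int (nat (t - m))" "nat (t - m) < L" by auto
    then show "t \<in> (\<lambda>j. m + int j) ` {j \<in> {..<L}. ws ! ((r + j) mod n) = i}"
      using t r[of "nat (t - m)"] by (auto simp: days_def n_def intro!: image_eqI[of _ _ "nat (t - m)"])
  qed (use r in \<open>auto simp: days_def n_def\<close>)
  then have "card (days ws i \<inter> {m..<m + int L}) = card {j \<in> {..<L}. ws ! ((r + j) mod n) = i}"
    by (simp add: card_image inj_on_def)
  also have "\<dots> = occs ws i r L"
    unfolding occs_def by (subst distinct_length_filter) (auto simp: n_def intro: arg_cong[where f = card])
  finally show ?thesis by (simp add: r_def n_def)
qed

text \<open>Write \<open>l = w * q + s\<close> with \<open>s < w\<close>: \<open>q\<close> full
  periods yield \<open>w * q\<close> executions, and \<open>Ls ! s\<close> further days yield the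
  other \<open>s\<close>. The slack \<open>+ 1\<close> in \<open>part\<close> is strict because an
  integer below \<open>x + 1\<close> is at most the ceiling of \<open>x\<close>; this lets
  \<open>Ls ! s\<close> exceed \<open>s * a\<close>.\<close>

lemma serves_days:
  assumes ws: "ws \<noteq> []" "Ls \<noteq> []"
    and full: "real (length ws) \<le> real (length Ls) * a"
    and part: "\<forall>s<length Ls. real (Ls ! s) < real s * a + 1"
    and dense: "dense_word ws i Ls"
  shows "serves (days ws i) a"
proof -
  define n where "n = length ws"
  define w where "w = length Ls"
  define cnt where "cnt m L = card (days ws i \<inter> {m..<m + int L})" for m L
  have nw: "n > 0" "w > 0" using ws by (auto simp: n_def w_def)
  have cnt: "cnt m L = occs ws i (nat (m mod int n)) L" and res: "nat (m mod int n) < n" for m L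
    using card_days[OF ws(1)] nw by (auto simp: cnt_def n_def nat_less_iff)
  have cnt_full: "w \<le> cnt m n" for m
    using dense res[of m] unfolding cnt by (simp add: dense_word_def n_def w_def)
  have cnt_part: "s \<le> cnt m (Ls ! s)" if "s < w" for s m
    using dense res[of m] that unfolding cnt by (simp add: dense_word_def n_def w_def)
  have cnt_add: "cnt m (K + L) = cnt m K + cnt (m + int K) L" for m K L
    unfolding cnt_def by (subst card_Un_disjoint[symmetric]) (auto intro!: arg_cong[where f = card])
  have cnt_mult: "w * q + s \<le> cnt m (n * q + Ls ! s)" if "s < w" for q s m
  proof (induction q arbitrary: m)
    case 0
    show ?case using cnt_part[OF that] by simp
  next
    case (Suc q)
    have "w + (w * q + s) \<le> cnt m n + cnt (m + int n) (n * q + Ls ! s)"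
      using cnt_full Suc.IH by (rule add_mono)
    then show ?case by (simp add: cnt_add[symmetric] add.assoc)
  qed
  show ?thesis
    unfolding serves_def
  proof (intro allI impI)
    fix l :: nat and m :: int
    define q where "q = l div w"
    define s where "s = l mod w"
    have s: "s < w" and l: "l = w * q + s" using nw by (auto simp: s_def q_def)
    have "real n * real q \<le> real w * a * real q"
      by (rule mult_right_mono) (use full in \<open>auto simp: n_def w_def\<close>)
    moreover have "real (Ls ! s) < real s * a + 1" using part s by (simp add: w_def)
    ultimately have "real (n * q + Ls ! s) < real l * a + 1"
      unfolding l by (simp add: algebra_simps)
    then have "int (n * q + Ls ! s) \<le> \<lceil>real l * a\<rceil>" by linarith
    then have "cnt m (n * q + Ls ! s) \<le> card (days ws i \<inter> {m..<m + \<lceil>real l * a\<rceil>})"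
      unfolding cnt_def by (intro card_mono) auto
    then show "l \<le> card (days ws i \<inter> {m..<m + \<lceil>real l * a\<rceil>})"
      using cnt_mult[OF s, of q m] l by linarith
  qed
qed

section \<open>Three tasks of total rate at most 5/6\<close>

definition feasible :: "real \<Rightarrow> real \<Rightarrow> real \<Rightarrow> bool" where
  "feasible a b c \<longleftrightarrow> (\<exists>P Q R. serves P a \<and> serves Q b \<and> serves R c
     \<and> P \<inter> Q = {} \<and> P \<inter> R = {} \<and> Q \<inter> R = {})"

text \<open>These two transpositions generate all orders of the three tasks.\<close>

lemma feasible_swap:
  assumes "feasible a b c"
  shows "feasible b a c" and "feasible a c b"
proof -
  obtain P Q R where "serves P a" "serves Q b" "serves R c"
    and "P \<inter> Q = {}" "P \<inter> R = {}" "Q \<inter> R = {}"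
    using assms unfolding feasible_def by blast
  moreover from this have "Q \<inter> P = {}" "R \<inter> Q = {}" by blast+
  ultimately show "feasible b a c" and "feasible a c b" unfolding feasible_def by blast+
qed

lemma feasible_days:
  assumes "serves (days ws 0) a" "serves (days ws 1) b" "serves (days ws 2) c"
  shows "feasible a b c"
proof -
  have "days ws 0 \<inter> days ws 1 = {}" "days ws 0 \<inter> days ws 2 = {}" "days ws 1 \<inter> days ws 2 = {}"
    by (auto simp: days_def)
  with assms show ?thesis unfolding feasible_def by blast
qed

text \<open>Alternating on the complement gives both other tasks the rate of the faster one, so the
  complement must serve period \<open>b / 2\<close>; this explains the term
  \<open>2 / b\<close>.\<close>

lemma feasible_beatty:
  assumes "a > 0" "b > 0" "b \<le> c" "1 / a + 2 / b \<le> 1"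
  shows "feasible a b c"
proof -
  obtain P where P: "serves P a" "serves (- P) (b / 2)"
    using serves_beatty[of a "b / 2"] assms by auto
  obtain Q :: "nat \<Rightarrow> int set" where Q: "disjoint_family Q" "\<forall>j. Q j \<subseteq> - P" "\<forall>j<2. serves (Q j) b"
    using serves_split[OF P(2), of 2] by auto
  have "Q 0 \<inter> Q 1 = {}" using Q(1) by (auto simp: disjoint_family_on_def)
  moreover have "serves (Q 1) c" using Q(3) assms(3) by (auto intro: serves_mono[of _ b])
  moreover have "serves (Q 0) b" using Q(3) by simp
  moreover have "P \<inter> Q 0 = {}" "P \<inter> Q 1 = {}" using Q(2) by blast+
  ultimately show ?thesis
    unfolding feasible_def using P(1) by blast
qed

text \<open>Task 1 has gaps 4 and 2. The gap 4 is allowed because \<open>b > 3\<close> rounds up to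
  at least 4.\<close>

lemma feasible_period_6:
  assumes "a \<ge> 2" "b > 3" "c \<ge> 6"
  shows "feasible a b c"
proof (rule feasible_days[where ws = "[0,1,0,2,0,1]"])
  have "dense_word [0,1,0,2,0,1] 0 [0, 2, 4]" by code_simp
  then show "serves (days [0,1,0,2,0,1] 0) a"
    by (rule serves_days[rotated -1]) (use assms in \<open>auto simp: All_less_Suc2\<close>)
  have "dense_word [0,1,0,2,0,1] 1 [0, 4]" by code_simp
  then show "serves (days [0,1,0,2,0,1] 1) b"
    by (rule serves_days[rotated -1]) (use assms in \<open>auto simp: All_less_Suc2\<close>)
  have "dense_word [0,1,0,2,0,1] 2 [0]" by code_simp
  then show "serves (days [0,1,0,2,0,1] 2) c"
    by (rule serves_days[rotated -1]) (use assms in \<open>auto simp: All_less_Suc2\<close>)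
qed

text \<open>Task 1 has gaps 4, 3, 2, 3, so \<open>s\<close> executions fit in
  \<open>3 * s + 1\<close> days. Task 0 fills 7 of the 12 days, whence the bound on
  \<open>a\<close>.\<close>

lemma feasible_period_12:
  assumes "a \<ge> 12 / 7" "b > 3" "c \<ge> 12"
  shows "feasible a b c"
proof (rule feasible_days[where ws = "[1,0,2,0,1,0,0,1,0,1,0,0]"])
  have "dense_word [1,0,2,0,1,0,0,1,0,1,0,0] 0 [0, 2, 4, 6, 7, 9, 11]" by code_simp
  then show "serves (days [1,0,2,0,1,0,0,1,0,1,0,0] 0) a"
    by (rule serves_days[rotated -1]) (use assms in \<open>auto simp: All_less_Suc2\<close>)
  have "dense_word [1,0,2,0,1,0,0,1,0,1,0,0] 1 [0, 4, 7, 10]" by code_simp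
  then show "serves (days [1,0,2,0,1,0,0,1,0,1,0,0] 1) b"
    by (rule serves_days[rotated -1]) (use assms in \<open>auto simp: All_less_Suc2\<close>)
  have "dense_word [1,0,2,0,1,0,0,1,0,1,0,0] 2 [0]" by code_simp
  then show "serves (days [1,0,2,0,1,0,0,1,0,1,0,0] 2) c"
    by (rule serves_days[rotated -1]) (use assms in \<open>auto simp: All_less_Suc2\<close>)
qed

text \<open>Task 1 has gaps 3, 3, 5; the gap 5 forces \<open>b > 4\<close>. Task 0 fills 7 of the 11
  days.\<close>

lemma feasible_period_11:
  assumes "a \<ge> 11 / 7" "b > 4" "c \<ge> 11"
  shows "feasible a b c"
proof (rule feasible_days[where ws = "[1,0,0,1,0,0,1,0,0,2,0]"])
  have "dense_word [1,0,0,1,0,0,1,0,0,2,0] 0 [0, 2, 4, 5, 7, 8, 10]" by code_simp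
  then show "serves (days [1,0,0,1,0,0,1,0,0,2,0] 0) a"
    by (rule serves_days[rotated -1]) (use assms in \<open>auto simp: All_less_Suc2\<close>)
  have "dense_word [1,0,0,1,0,0,1,0,0,2,0] 1 [0, 5, 9]" by code_simp
  then show "serves (days [1,0,0,1,0,0,1,0,0,2,0] 1) b"
    by (rule serves_days[rotated -1]) (use assms in \<open>auto simp: All_less_Suc2\<close>)
  have "dense_word [1,0,0,1,0,0,1,0,0,2,0] 2 [0]" by code_simp
  then show "serves (days [1,0,0,1,0,0,1,0,0,2,0] 2) c"
    by (rule serves_days[rotated -1]) (use assms in \<open>auto simp: All_less_Suc2\<close>)
qed

text \<open>Task 1 has gaps 3 and 6; the gap 6 forces \<open>b > 5\<close>. Task 0 fills 6 of the 9
  days.\<close>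

lemma feasible_period_9:
  assumes "a \<ge> 3 / 2" "b > 5" "c \<ge> 9"
  shows "feasible a b c"
proof (rule feasible_days[where ws = "[1,0,0,1,0,0,2,0,0]"])
  have "dense_word [1,0,0,1,0,0,2,0,0] 0 [0, 2, 3, 5, 6, 8]" by code_simp
  then show "serves (days [1,0,0,1,0,0,2,0,0] 0) a"
    by (rule serves_days[rotated -1]) (use assms in \<open>auto simp: All_less_Suc2\<close>)
  have "dense_word [1,0,0,1,0,0,2,0,0] 1 [0, 6]" by code_simp
  then show "serves (days [1,0,0,1,0,0,2,0,0] 1) b"
    by (rule serves_days[rotated -1]) (use assms in \<open>auto simp: All_less_Suc2\<close>)
  have "dense_word [1,0,0,1,0,0,2,0,0] 2 [0]" by code_simp
  then show "serves (days [1,0,0,1,0,0,2,0,0] 2) c"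
    by (rule serves_days[rotated -1]) (use assms in \<open>auto simp: All_less_Suc2\<close>)
qed

lemma feasible_sorted:
  assumes pos: "0 < a" "a \<le> b" "b \<le> c" and sum: "1 / a + 1 / b + 1 / c \<le> 5 / 6"
  shows "feasible a b c"
proof -
  define p q r where "p = 1 / a" and "q = 1 / b" and "r = 1 / c"
  have a: "a = 1 / p" "b = 1 / q" "c = 1 / r" by (simp_all add: p_def q_def r_def)
  have pqr: "0 < r" "r \<le> q" "q \<le> p" "p + q + r \<le> 5 / 6"
    using pos sum by (auto simp: p_def q_def r_def frac_le)
  consider "p + 2 * q \<le> 1" | "r + 2 * p \<le> 1" | "1 < p + 2 * q" "1 < r + 2 * p" by linarith
  then show ?thesis
  proof cases
    case 1
    then show ?thesis using pos by (intro feasible_beatty) (auto simp: p_def q_def)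
  next
    case 2
    \<comment> \<open>The rarest task takes the Beatty sequence and the other two alternate, each at
      rate \<open>p\<close>.\<close>
    then have "feasible c a b" using pos by (intro feasible_beatty) (auto simp: p_def r_def)
    then show ?thesis using feasible_swap by blast
  next
    case 3
    \<comment> \<open>Subtracting the sum bound gives \<open>q - r > 1 / 6\<close> and
      \<open>p - q > 1 / 6\<close>; substituting these back into the sum yields all four
      bounds.\<close>
    then have q: "1 / 6 < q" "q < 1 / 3" and r: "r < 1 / 9" and p: "p < 2 / 3" using pqr by linarith+
    have ge: "x \<le> 1 / y" if "0 < y" "x * y \<le> 1" for x y :: real using that by (simp add: field_simps)
    have gt: "x < 1 / y" if "0 < y" "x * y < 1" for x y :: real using that by (simp add: field_simps)
    \<comment> \<open>The cuts \<open>1 / 4\<close> and \<open>1 / 5\<close> mark where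
      \<open>b\<close> passes 4 and 5. As \<open>q\<close> shrinks, \<open>p\<close> may grow, and
      the words give task 0 the rates 1/2, 7/12, 7/11 and 2/3.\<close>
    consider "p \<le> 1 / 2" | "1 / 2 < p" "1 / 4 \<le> q" | "1 / 2 < p" "1 / 5 \<le> q" "q < 1 / 4" | "q < 1 / 5"
      by linarith
    then show ?thesis
    proof cases
      case 1
      then show ?thesis unfolding a
        by (intro feasible_period_6 ge gt) (use pqr q r in linarith)+
    next
      \<comment> \<open>Here \<open>p < 5 / 6 - 1 / 4 = 7 / 12\<close> and
        \<open>r < 5 / 6 - 1 / 2 - 1 / 4 = 1 / 12\<close>.\<close>
      case 2
      with 3 pqr show ?thesis unfolding a
        by (intro feasible_period_12 ge gt) linarith+
    next
      \<comment> \<open>Here \<open>p < 5 / 6 - 1 / 5 = 19 / 30 < 7 / 11\<close> and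
        \<open>r < q - 1 / 6 < 1 / 12\<close>.\<close>
      case 3
      with \<open>1 < r + 2 * p\<close> \<open>1 < p + 2 * q\<close> pqr show ?thesis unfolding a
        by (intro feasible_period_11 ge gt) linarith+
    next
      case 4
      then show ?thesis unfolding a
        by (intro feasible_period_9 ge gt) (use pqr p q r in linarith)+
    qed
  qed
qed

lemma feasible_five_sixths:
  assumes pos: "0 < a" "0 < b" "0 < c" and sum: "1 / a + 1 / b + 1 / c \<le> 5 / 6"
  shows "feasible a b c"
proof -
  have "feasible a b c" if "a \<le> b" "0 < a" "0 < b" "0 < c" "1 / a + 1 / b + 1 / c \<le> 5 / 6" for a b c
  proof -
    consider "b \<le> c" | "a \<le> c" "c \<le> b" | "c \<le> a" by linarith
    then show ?thesis
    proof cases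
      case 1
      with that show ?thesis by (intro feasible_sorted)
    next
      case 2
      with that have "feasible a c b" by (intro feasible_sorted) auto
      then show ?thesis by (rule feasible_swap)
    next
      case 3
      with that have "feasible c a b" by (intro feasible_sorted) auto
      then show ?thesis by (rule feasible_swap(2)[OF feasible_swap(1)])
    qed
  qed
  note ordered = this
  show ?thesis
  proof (cases "a \<le> b")
    case True
    with assms show ?thesis by (intro ordered)
  next
    case False
    with assms have "feasible b a c" by (intro ordered) auto
    then show ?thesis by (rule feasible_swap)
  qed
qed

section \<open>From three merged tasks back to the instance\<close>

text \<open>This turns the density into a sum over the distinct periods, weighted by
  multiplicity.\<close>

lemma sum_nth_by_value:
  fixes g :: "'a \<Rightarrow> 'b :: semiring_1"
  shows "(\<Sum>i<length xs. g (xs ! i)) = (\<Sum>x\<in>set xs. of_nat (card {i. i < length xs \<and> xs ! i = x}) * g x)"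
proof -
  have "(\<Sum>i<length xs. g (xs ! i))
      = (\<Sum>x\<in>set xs. \<Sum>i\<in>{i \<in> {..<length xs}. xs ! i = x}. g (xs ! i))"
    by (rule sum.group[symmetric]) auto
  also have "\<dots> = (\<Sum>x\<in>set xs. of_nat (card {i. i < length xs \<and> xs ! i = x}) * g x)"
    by (intro sum.cong refl) simp
  finally show ?thesis .
qed

text \<open>Idle days go to task 0, which exists as \<open>A\<close> is nonempty; extra executions
  cannot break a lower bound.\<close>

lemma schedulable_if_disjoint:
  assumes ne: "A \<noteq> []"
    and serves: "\<And>i. i < length A \<Longrightarrow> serves (P i) (A ! i)"
    and disj: "disjoint_family_on P {..<length A}"
  shows "schedulable A"
proof -
  define S where "S t = (if \<exists>i<length A. t \<in> P i then (THE i. i < length A \<and> t \<in> P i) else 0)" for t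
  have S: "S t = i" if "i < length A" "t \<in> P i" for t i
  proof -
    have "(THE i. i < length A \<and> t \<in> P i) = i"
      using that disj by (intro the_equality) (auto simp: disjoint_family_on_def)
    then show ?thesis using that by (auto simp: S_def)
  qed
  have "S t < length A" for t
    using S[of _ t] ne by (cases "\<exists>i<length A. t \<in> P i") (auto simp: S_def[of t])
  moreover have "l \<le> card {t \<in> {m..<m + \<lceil>real l * A ! i\<rceil>}. S t = i}" if "i < length A" "l > 0" for i l m
  proof -
    have "l \<le> card (P i \<inter> {m..<m + \<lceil>real l * A ! i\<rceil>})"
      using serves[OF that(1)] that(2) by (auto simp: serves_def)
    also have "\<dots> \<le> card {t \<in> {m..<m + \<lceil>real l * A ! i\<rceil>}. S t = i}"
      using S[OF that(1)] by (intro card_mono) (auto intro: finite_subset[of _ "{m..<m + \<lceil>real l * A ! i\<rceil>}"])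
    finally show ?thesis .
  qed
  ultimately show ?thesis unfolding schedulable_def valid_schedule_def schedule_def by blast
qed

theorem theorem2:
  fixes A :: "real list"
  assumes "pinwheel_instance A"
    and "card (set A) = 3"
    and "density A \<le> 5 / 6"
  shows "schedulable A"
proof -
  obtain x y z where A: "set A = {x, y, z}" and ne: "x \<noteq> y" "x \<noteq> z" "y \<noteq> z"
    using assms(2) by (metis card_3_iff)
  define I where "I v = {i. i < length A \<and> A ! i = v}" for v
  define u where "u v = card (I v)" for v
  have fin: "finite (I v)" for v by (simp add: I_def)
  have u: "u v > 0" if "v \<in> set A" for v
    using that fin[of v] by (auto simp: u_def card_gt_0_iff I_def in_set_conv_nth)
  have pos: "v > 0" if "v \<in> set A" for v
    using assms(1) that by (force simp: pinwheel_instance_def)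
  have "density A = (\<Sum>v\<in>set A. real (u v) * (1 / v))"
    unfolding density_def u_def I_def by (rule sum_nth_by_value)
  \<comment> \<open>The \<open>u v\<close> tasks of period \<open>v\<close> merge into one of period
    \<open>v / u v\<close>, so the three merged rates add up to the density.\<close>
  with assms(3) ne have "1 / (x / u x) + 1 / (y / u y) + 1 / (z / u z) \<le> 5 / 6"
    by (simp add: A add_ac)
  then have "feasible (x / u x) (y / u y) (z / u z)"
    using u pos A by (intro feasible_five_sixths) auto
  then obtain X Y Z where XYZ: "serves X (x / u x)" "serves Y (y / u y)" "serves Z (z / u z)"
    "X \<inter> Y = {}" "X \<inter> Z = {}" "Y \<inter> Z = {}"
    unfolding feasible_def by blast
  define T where "T v = (if v = x then X else if v = y then Y else Z)" for v
  have T: "serves (T v) (v / u v)" if "v \<in> set A" for v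
    using that XYZ ne by (auto simp: T_def A)
  have T_disj: "T v \<inter> T w = {}" if "v \<in> set A" "w \<in> set A" "v \<noteq> w" for v w
    using that XYZ ne by (auto simp: T_def A)
  \<comment> \<open>Splitting a set that serves \<open>v / u v\<close> into \<open>u v\<close> parts
    restores the period \<open>v\<close>.\<close>
  have "\<exists>Q :: nat \<Rightarrow> int set. disjoint_family Q \<and> (\<forall>j. Q j \<subseteq> T v) \<and> (\<forall>j<u v. serves (Q j) v)"
    if "v \<in> set A" for v
    using serves_split[OF T[OF that] u[OF that]] u[OF that] by simp
  then obtain Q :: "real \<Rightarrow> nat \<Rightarrow> int set" where Q: "disjoint_family (Q v)" "Q v j \<subseteq> T v"
    "j < u v \<Longrightarrow> serves (Q v j) v" if "v \<in> set A" for v j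
    by metis
  have "\<exists>e. bij_betw e (I v) {..<u v}" for v
    using ex_bij_betw_finite_nat[OF fin[of v]] by (simp add: u_def atLeast0LessThan)
  then obtain e where e: "bij_betw (e v) (I v) {..<u v}" for v by metis
  define P where "P i = Q (A ! i) (e (A ! i) i)" for i
  show ?thesis
  proof (rule schedulable_if_disjoint)
    show "A \<noteq> []" using A by auto
  next
    fix i assume i: "i < length A"
    then have "e (A ! i) i < u (A ! i)"
      using bij_betwE[OF e[of "A ! i"]] by (auto simp: I_def)
    then show "serves (P i) (A ! i)" using Q(3) i by (simp add: P_def)
  next
    show "disjoint_family_on P {..<length A}"
      unfolding disjoint_family_on_def
    proof (intro ballI impI)
      fix i j assume ij: "i \<in> {..<length A}" "j \<in> {..<length A}" "i \<noteq> j"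
      \<comment> \<open>Tasks of equal period hold different parts of the same split, since
        \<open>e\<close> is injective; tasks of different periods lie in disjoint sets
        \<open>T\<close>.\<close>
      show "P i \<inter> P j = {}"
      proof (cases "A ! i = A ! j")
        case True
        then have "e (A ! i) i \<noteq> e (A ! i) j"
          using ij e[of "A ! i"] by (auto simp: bij_betw_def inj_on_def I_def)
        then show ?thesis
          using Q(1)[of "A ! i"] ij True by (auto simp: P_def disjoint_family_on_def)
      next
        case False
        then show ?thesis
          using T_disj[of "A ! i" "A ! j"] Q(2)[of "A ! i"] Q(2)[of "A ! j"] ij
          unfolding P_def by (meson disjoint_iff lessThan_iff nth_mem subsetD)
      qed
    qed
  qed
qed

end
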